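(* Suppose $2\mid n$ but $4\nmid n$. If $\phi$ is an $\{n/2,n\}$-isometry of $\mathcal{C}_n$ fixing the set $\{\overline{0},\overline{1}\}$, then there are a permutation $\pi$ of $\{1,\ldots,n\}$ and a subset $S$ of $X$ such that, for all $\overline{c}\in\mathcal{C}_n$, $$\phi(\overline{c})=\begin{cases} \pi(\overline{c}) & \text{if } \{\overline{c},\overline{1}+\overline{c}\}\cap S=\emptyset,\\ \pi(\overline{c})+\overline{1} & \text{if } \{\overline{c},\overline{1}+\overline{c}\}\cap S\neq\emptyset.\end{cases}$$ Conversely, for any permutation $\pi$ of $\{1,\ldots,n\}$ and any $S\subset X$, this formula defines an $\{n/2,n\}$-isometry fixing the set $\{\overline{0},\overline{1}\}$.
   Context: $\mathcal{C}_n=\{0,1\}^n$ is the Boolean cube with Hamming distance $d$ and component-wise addition modulo $2$; $\overline{0}=(0,\ldots,0)$, $\overline{1}=(1,\ldots,1)$. The weight of a word is its number of non-zero positions. For $n$ even, $X=X_1\cup X_2$, where $X_1$ is the set of all words of weight less than $n/2$ and $X_2$ is the set of all words of weight $n/2$ whose first coordinate is $0$. A permutation $\pi$ of $\{1,\ldots,n\}$ is identified with the map $\pi(x_1,\ldots,x_n)=(x_{\pi(1)},\ldots,x_{\pi(n)})$ on $\mathcal{C}_n$. An $\{n/2,n\}$-isometry is a bijection $\phi$ of $\mathcal{C}_n$ such that, for each $p\in\{n/2,n\}$, $d(\phi(x),\phi(y))=p$ whenever $d(x,y)=p$. Fixing the set $\{\overline{0},\overline{1}\}$ means mapping it onto itself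 (setwise). *)

theory Defs
  imports Main "HOL-Library.FuncSet" "HOL-Library.Z2" "HOL-Combinatorics.Permutations"
begin

(* Words are extensional functions on {1..n} (undefined outside) with values in the field bit of
   two elements, so that equality of words is equality of functions. *)

definition cube :: "nat \<Rightarrow> (nat \<Rightarrow> bit) set" where
  "cube n = {1..n} \<rightarrow>\<^sub>E UNIV"

definition zero_word :: "nat \<Rightarrow> nat \<Rightarrow> bit" where
  "zero_word n = (\<lambda>i\<in>{1..n}. 0)"

definition one_word :: "nat \<Rightarrow> nat \<Rightarrow> bit" where
  "one_word n = (\<lambda>i\<in>{1..n}. 1)"

definition add_word :: "nat \<Rightarrow> (nat \<Rightarrow> bit) \<Rightarrow> (nat \<Rightarrow> bit) \<Rightarrow> nat \<Rightarrow> bit" where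
  "add_word n x y = (\<lambda>i\<in>{1..n}. x i + y i)"

definition hamming_dist :: "nat \<Rightarrow> (nat \<Rightarrow> bit) \<Rightarrow> (nat \<Rightarrow> bit) \<Rightarrow> nat" where
  "hamming_dist n x y = card {i \<in> {1..n}. x i \<noteq> y i}"

definition weight :: "nat \<Rightarrow> (nat \<Rightarrow> bit) \<Rightarrow> nat" where
  "weight n x = card {i \<in> {1..n}. x i \<noteq> 0}"

definition perm_word :: "nat \<Rightarrow> (nat \<Rightarrow> nat) \<Rightarrow> (nat \<Rightarrow> bit) \<Rightarrow> nat \<Rightarrow> bit" where
  "perm_word n \<pi> x = (\<lambda>i\<in>{1..n}. x (\<pi> i))"

definition dist_isometry :: "nat \<Rightarrow> nat set \<Rightarrow> ((nat \<Rightarrow> bit) \<Rightarrow> (nat \<Rightarrow> bit)) \<Rightarrow> bool" where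
  "dist_isometry n P \<phi> \<longleftrightarrow>
     bij_betw \<phi> (cube n) (cube n) \<and>
     (\<forall>p\<in>P. \<forall>x\<in>cube n. \<forall>y\<in>cube n.
        hamming_dist n x y = p \<longrightarrow> hamming_dist n (\<phi> x) (\<phi> y) = p)"

(* Intended for even n only: X1 \<union> X2 then contains exactly one word of each complementary pair. *)

definition X1 :: "nat \<Rightarrow> (nat \<Rightarrow> bit) set" where
  "X1 n = {x \<in> cube n. weight n x < n div 2}"

definition X2 :: "nat \<Rightarrow> (nat \<Rightarrow> bit) set" where
  "X2 n = {x \<in> cube n. weight n x = n div 2 \<and> x 1 = 0}"

definition X :: "nat \<Rightarrow> (nat \<Rightarrow> bit) set" where
  "X n = X1 n \<union> X2 n"

definition flipped_perm ::
    "nat \<Rightarrow> (nat \<Rightarrow> nat) \<Rightarrow> (nat \<Rightarrow> bit) set \<Rightarrow> (nat \<Rightarrow> bit) \<Rightarrow> nat \<Rightarrow> bit" where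
  "flipped_perm n \<pi> S c =
     (if {c, add_word n (one_word n) c} \<inter> S = {} then perm_word n \<pi> c
      else add_word n (perm_word n \<pi> c) (one_word n))"

end

theory Submission
  imports Defs
begin

text \<open>
  Identify a word with its support, a subset of \<open>U = {1..n}\<close>, where \<open>n = 2m\<close> and \<open>m\<close> is odd.
  Hamming distance becomes the size of the symmetric difference, adding \<open>one_word n\<close> becomes complementation,
  and an isometry becomes a bijection \<open>F\<close> of the power set of \<open>U\<close> that commutes with complements and
  preserves the distance \<open>m\<close>. Replacing \<open>B\<close> by its complement turns a distance \<open>d\<close> into \<open>n - d\<close>, so
  distance \<open>m\<close> cannot tell a set from its complement. This ambiguity is the reason why an arbitrary
  \<open>S\<close> may occur, and why any choice of \<open>S\<close> gives an isometry. The content of the theorem is that,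
  up to complements, \<open>F\<close> is induced by a permutation of \<open>U\<close>.

  The number of sets at distance \<open>m\<close> from both \<open>A\<close> and \<open>B\<close> is zero if the distance \<open>d\<close> of \<open>A\<close> and \<open>B\<close>
  is odd. If \<open>d = 2j\<close>, it is the product of the central binomial coefficients of \<open>2j\<close> and \<open>2(m - j)\<close>,
  which strictly decreases as \<open>j\<close> grows to \<open>m/2\<close> (\<open>card_common_nbrs\<close>,
  \<open>nbr_count_inject\<close>). As \<open>F\<close> preserves these numbers, it preserves the parity of every distance
  and every even distance \<open>d\<close> up to exchanging \<open>d\<close> and \<open>n - d\<close> (\<open>even_dist\<close>).

  The singletons and their complements are the sets of odd size whose distance to every \<open>m\<close>-set is
  \<open>m - 1\<close> or \<open>m + 1\<close>, and \<open>F\<close> preserves this property (\<open>singleton_image\<close>). So \<open>F\<close> permutes the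
  singletons up to complements, and after composition with a permutation of \<open>U\<close> it fixes each of
  them up to complement. It commutes with complements and maps \<open>{}\<close> to \<open>{}\<close> or \<open>U\<close>. If \<open>m > 1\<close>, it also
  fixes every other set up to complement:
  \<^item> a set \<open>A\<close> of odd size other than \<open>m\<close> can be read off from its distances to the singletons;
  \<^item> a proper nonempty set \<open>A\<close> of even size is recovered from the sets of odd size other than \<open>m\<close> at distance \<open>m\<close>
    from it: \<open>A\<close> separates \<open>i\<close> from \<open>j\<close> exactly when some such set \<open>Y\<close> that separates them is no
    longer at distance \<open>m\<close> after \<open>i\<close> and \<open>j\<close> have been exchanged in it (\<open>F_separates\<close>);
  \<^item> a set of size \<open>m\<close> is recovered in the same way from the sets of even size.

  If \<open>m = 1\<close>, all this is trivial, because any two sets of equal size agree up to complement.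
\<close>

section \<open>Counting common neighbours\<close>

lemma central_binomial_Suc:
  "(2 * Suc k choose Suc k) * Suc k = (2 * k choose k) * (2 * (2 * k + 1))"
proof -
  have sym: "Suc (2 * k) choose k = Suc (2 * k) choose Suc k"
    using binomial_symmetric[of k "Suc (2 * k)"] by simp
  have "(2 * Suc k choose Suc k) * Suc k = 2 * ((Suc (2 * k) choose Suc k) * Suc k)"
    using Suc_times_binomial_eq[of "Suc (2 * k)" k] sym by simp
  also have "(Suc (2 * k) choose Suc k) * Suc k = Suc (2 * k) * (2 * k choose k)"
    using Suc_times_binomial_eq[of "2 * k" k] by simp
  finally show ?thesis by (simp add: algebra_simps)
qed

text \<open>
  The number of sets at distance \<open>m\<close> from two subsets of a \<open>2m\<close>-set whose distance is \<open>2j\<close>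
  (lemma \<open>card_common_nbrs\<close> below).
\<close>
definition nbr_count :: "nat \<Rightarrow> nat \<Rightarrow> nat" where
  "nbr_count m j = (2 * j choose j) * (2 * (m - j) choose (m - j))"

lemma nbr_count_pos: "nbr_count m j > 0"
  by (simp add: nbr_count_def)

lemma nbr_count_symmetric: "j \<le> m \<Longrightarrow> nbr_count m (m - j) = nbr_count m j"
  by (simp add: nbr_count_def)

text \<open>
  With \<open>m = j + l + 1\<close>, the recursion for central binomial coefficients gives
  \<open>nbr_count m (j + 1) / nbr_count m j = ((2j + 1)(l + 1)) / ((2l + 1)(j + 1))\<close>,
  and this is less than \<open>1\<close> exactly when \<open>j < l\<close>.
\<close>
lemma nbr_count_Suc_less:
  assumes "2 * j + 1 < m"
  shows "nbr_count m (Suc j) < nbr_count m j"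
proof -
  obtain l where l: "m = Suc (j + l)" "j < l"
    using assms by (intro that[of "m - Suc j"]) auto
  let ?c = "\<lambda>k. 2 * k choose k"
  have c: "?c (Suc k) * Suc k = ?c k * (2 * (2 * k + 1))" for k
    by (rule central_binomial_Suc)
  let ?P = "?c j * ?c l"
  have "nbr_count m (Suc j) * (Suc j * Suc l) = (?c (Suc j) * Suc j) * (?c l * Suc l)"
    using l by (simp only: nbr_count_def diff_Suc_Suc mult.assoc mult.left_commute add_diff_cancel_left' mult.commute)
  also have "\<dots> = ?P * (2 * ((2 * j + 1) * Suc l))"
    unfolding c by (simp only: mult_ac)
  also have "\<dots> < ?P * (2 * ((2 * l + 1) * Suc j))"
    using l(2) by (simp add: algebra_simps)
  also have "\<dots> = (?c j * Suc j) * (?c (Suc l) * Suc l)"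
    unfolding c by (simp only: mult_ac)
  also have "\<dots> = nbr_count m j * (Suc j * Suc l)"
  proof -
    have "m - j = Suc l" using l by simp
    then show ?thesis by (simp only: nbr_count_def mult_ac)
  qed
  finally show ?thesis by (simp only: mult_less_cancel2)
qed

lemma nbr_count_strict_decreasing:
  assumes "i < j" "2 * j \<le> m"
  shows "nbr_count m j < nbr_count m i"
  using assms
proof (induction j)
  case (Suc j)
  have "nbr_count m (Suc j) < nbr_count m j"
    using Suc.prems by (intro nbr_count_Suc_less) auto
  with Suc show ?case by (cases "i = j") auto
qed simp

lemma nbr_count_inject:
  assumes "i \<le> m" "j \<le> m" "nbr_count m i = nbr_count m j"
  shows "i = j \<or> i + j = m"
proof -
  have inj: "a = b" if "2 * a \<le> m" "2 * b \<le> m" "nbr_count m a = nbr_count m b" for a b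
    using nbr_count_strict_decreasing[of a b m] nbr_count_strict_decreasing[of b a m] that
    by (cases a b rule: linorder_cases) auto
  \<comment> \<open>Reflect both indices into the lower half, where the count is injective.\<close>
  define r where "r k = (if 2 * k \<le> m then k else m - k)" for k
  have "nbr_count m (r i) = nbr_count m (r j)"
    using assms by (simp add: r_def nbr_count_symmetric)
  then have "r i = r j"
    by (rule inj[rotated 2]) (use assms(1,2) in \<open>auto simp: r_def\<close>)
  then show ?thesis using assms(1,2) by (auto simp: r_def split: if_splits)
qed

section \<open>Symmetric differences\<close>

lemma card_sym_diff_add:
  assumes "finite A" "finite B"
  shows "card (sym_diff A B) + 2 * card (A \<inter> B) = card A + card B"
proof -
  have "card (sym_diff A B) = card (A - B) + card (B - A)"
    using assms by (intro card_Un_disjoint) auto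
  moreover have "card A = card (A - B) + card (A \<inter> B)"
    using assms by (subst card_Un_disjoint[symmetric]) (auto intro: arg_cong[where f = card])
  moreover have "card B = card (B - A) + card (A \<inter> B)"
    using assms by (subst card_Un_disjoint[symmetric]) (auto intro: arg_cong[where f = card])
  ultimately show ?thesis by simp
qed

lemma even_card_sym_diff:
  assumes "finite A" "finite B"
  shows "even (card (sym_diff A B)) \<longleftrightarrow> (even (card A) \<longleftrightarrow> even (card B))"
proof -
  have "even (card (sym_diff A B)) \<longleftrightarrow> even (card A + card B)"
    by (subst card_sym_diff_add[OF assms, symmetric]) simp
  then show ?thesis by simp
qed

lemma card_sym_diff_compl:
  assumes "finite U" "A \<subseteq> U" "B \<subseteq> U"
  shows "card (sym_diff (U - A) B) + card (sym_diff A B) = card U"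
proof -
  have "sym_diff (U - A) B = U - sym_diff A B" using assms by auto
  moreover have "card (sym_diff A B) \<le> card U" using assms by (intro card_mono) auto
  moreover have "finite (sym_diff A B)" "sym_diff A B \<subseteq> U"
    using assms finite_subset[of _ U] by auto
  ultimately show ?thesis by (simp only: card_Diff_subset le_add_diff_inverse2)
qed

lemma card_sym_diff_le:
  assumes "finite U" "A \<subseteq> U" "B \<subseteq> U"
  shows "card (sym_diff A B) \<le> card U"
  using assms by (intro card_mono) auto

definition separates :: "'a set \<Rightarrow> 'a \<Rightarrow> 'a \<Rightarrow> bool" where
  "separates A i j \<longleftrightarrow> (i \<in> A) \<noteq> (j \<in> A)"

text \<open>
  Toggling both \<open>i\<close> and \<open>j\<close> changes the size by \<open>0\<close> if exactly one of them belongs to \<open>D\<close>, and by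
  \<open>\<plusminus>2\<close> otherwise. Sizes, hence distances, can thus detect separation.
\<close>
lemma card_sym_diff_pair_eq_iff:
  assumes "finite D" "i \<noteq> j"
  shows "card (sym_diff D {i, j}) = card D \<longleftrightarrow> separates D i j"
proof -
  have "card (sym_diff D {i, j}) + 2 * card (D \<inter> {i, j}) = card D + 2"
    using card_sym_diff_add[of D "{i, j}"] assms by simp
  moreover have "card (D \<inter> {i, j}) = (if i \<in> D then 1 else 0) + (if j \<in> D then 1 else 0)"
    using assms(2) by auto
  ultimately show ?thesis by (auto simp: separates_def split: if_splits)
qed

text \<open>
  Translation by \<open>A\<close> moves \<open>A\<close> to the empty set and \<open>B\<close> to \<open>T = sym_diff A B\<close>. The common neighbours
  become the \<open>m\<close>-sets \<open>E\<close> that contain exactly half of \<open>T\<close>, so the parts of \<open>E\<close> inside and outside \<open>T\<close>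
  are chosen independently.
\<close>
lemma card_common_nbrs:
  assumes "finite U" "card U = 2 * m" "A \<subseteq> U" "B \<subseteq> U"
  shows "card {C \<in> Pow U. card (sym_diff A C) = m \<and> card (sym_diff B C) = m} =
    (if even (card (sym_diff A B)) then nbr_count m (card (sym_diff A B) div 2) else 0)"
proof -
  let ?S = "sym_diff A B"
  let ?N = "{C \<in> Pow U. card (sym_diff A C) = m \<and> card (sym_diff B C) = m}"
  let ?E = "{E \<in> Pow U. card E = m \<and> card (sym_diff E ?S) = m}"
  have S: "?S \<subseteq> U" "finite ?S" using assms finite_subset[of _ U] by auto
  have tr: "sym_diff A (sym_diff A E) = E" "sym_diff B (sym_diff A E) = sym_diff E ?S"
    "sym_diff (sym_diff A E) ?S = sym_diff B E" for E by blast+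
  have sub: "sym_diff A E \<subseteq> U" if "E \<subseteq> U" for E using that assms(3) by blast
  have "bij_betw (\<lambda>E. sym_diff A E) ?E ?N"
  proof (rule bij_betw_byWitness[where f' = "\<lambda>E. sym_diff A E"])
    show "(\<lambda>E. sym_diff A E) ` ?E \<subseteq> ?N"
    proof (rule image_subsetI)
      fix E assume "E \<in> ?E"
      then show "sym_diff A E \<in> ?N"
        using sub[of E] unfolding mem_Collect_eq Pow_iff tr by blast
    qed
    show "(\<lambda>E. sym_diff A E) ` ?N \<subseteq> ?E"
    proof (rule image_subsetI)
      fix E assume "E \<in> ?N"
      then show "sym_diff A E \<in> ?E"
        using sub[of E] unfolding mem_Collect_eq Pow_iff tr by blast
    qed
  qed (simp_all only: tr Ball_def simp_thms)
  then have "card ?N = card ?E" by (rule bij_betw_same_card[symmetric])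
  also have "card ?E = (if even (card ?S) then nbr_count m (card ?S div 2) else 0)"
  proof (cases "even (card ?S)")
    case False
    have "?E = {}"
    proof (intro equals0I)
      fix E assume "E \<in> ?E"
      then have "finite E" "card E = m" "card (sym_diff E ?S) = m"
        using assms(1) finite_subset by auto
      with card_sym_diff_add[of E ?S] S have "2 * card (E \<inter> ?S) = card ?S" by simp
      then have "even (card ?S)" by (metis dvd_triv_left)
      with False show False by simp
    qed
    with False show ?thesis by (simp only: card.empty if_False)
  next
    case True
    then obtain j where j: "card ?S = 2 * j" by blast
    have jm: "j \<le> m" using card_mono[OF assms(1) S(1)] j assms(2) by simp
    define T where "T = ?S"
    let ?P = "{P. P \<subseteq> T \<and> card P = j}" and ?Q = "{Q. Q \<subseteq> U - T \<and> card Q = m - j}"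
    have T: "T \<subseteq> U" "finite T" "card T = 2 * j" using S j by (auto simp: T_def)
    have E: "?E = {E. E \<subseteq> U \<and> card (E \<inter> T) = j \<and> card (E - T) = m - j}"
    proof -
      have "(card E = m \<and> card (sym_diff E T) = m) \<longleftrightarrow> (card (E \<inter> T) = j \<and> card (E - T) = m - j)"
        if "E \<subseteq> U" for E
      proof -
        have "finite E" using that assms(1) finite_subset by blast
        then have "card E = card (E \<inter> T) + card (E - T)"
          by (subst card_Un_disjoint[symmetric]) (auto intro: arg_cong[where f = card])
        with card_sym_diff_add[OF \<open>finite E\<close> T(2)] T(3) jm show ?thesis by auto
      qed
      then show ?thesis unfolding T_def by blast
    qed
    have "bij_betw (\<lambda>(P, Q). P \<union> Q) (?P \<times> ?Q) ?E"
      unfolding E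
    proof (rule bij_betw_byWitness[where f' = "\<lambda>E. (E \<inter> T, E - T)"])
      show "(\<lambda>(P, Q). P \<union> Q) ` (?P \<times> ?Q) \<subseteq> {E. E \<subseteq> U \<and> card (E \<inter> T) = j \<and> card (E - T) = m - j}"
      proof (clarsimp simp del: Int_Un_distrib2 Un_Diff, intro conjI)
        fix P Q assume a: "P \<subseteq> T" "Q \<subseteq> U - T" "j = card P" "card Q = m - card P"
        have "(P \<union> Q) \<inter> T = P" "P \<union> Q - T = Q" using a by auto
        then show "card ((P \<union> Q) \<inter> T) = card P" "card (P \<union> Q - T) = m - card P" "P \<subseteq> U"
          "Q \<subseteq> U" using a T(1) by auto
      qed
    qed auto
    then have "card ?E = card (?P \<times> ?Q)" by (rule bij_betw_same_card[symmetric])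
    also have "\<dots> = (2 * j choose j) * (2 * (m - j) choose (m - j))"
    proof -
      have "card (U - T) = 2 * (m - j)" using T assms(2) by (simp add: card_Diff_subset)
      then show ?thesis
        using n_subsets[OF T(2), of j] n_subsets[of "U - T" "m - j"] assms(1) T(3)
        by (simp add: card_cartesian_product)
    qed
    finally show ?thesis using j by (simp add: nbr_count_def)
  qed
  finally show ?thesis .
qed

definition same_up_to_compl :: "'a set \<Rightarrow> 'a set \<Rightarrow> 'a set \<Rightarrow> bool" where
  "same_up_to_compl U A B \<longleftrightarrow> B = A \<or> B = U - A"

text \<open>
  Seen up to complement, a proper nonempty set is a partition of \<open>U\<close> into two blocks; it is
  determined by the pairs that it separates, because these form a connected bipartite graph.
\<close>
lemma same_up_to_complI:
  assumes "A \<subseteq> U" "B \<subseteq> U" "a \<in> A" "b \<in> U - A"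
    and "\<And>i j. i \<in> A \<Longrightarrow> j \<in> U - A \<Longrightarrow> separates B i j"
  shows "same_up_to_compl U A B"
proof (cases "a \<in> B")
  case True
  then have "j \<notin> B" if "j \<in> U - A" for j
    using assms(3) assms(5)[of a j] that by (auto simp: separates_def)
  moreover have "i \<in> B" if "i \<in> A" for i
    using assms(5)[of i b] that assms(4) calculation[of b] by (auto simp: separates_def)
  ultimately have "B = A" using assms(1,2) by blast
  then show ?thesis by (simp add: same_up_to_compl_def)
next
  case False
  then have "j \<in> B" if "j \<in> U - A" for j
    using assms(3) assms(5)[of a j] that by (auto simp: separates_def)
  moreover have "i \<notin> B" if "i \<in> A" for i
    using assms(5)[of i b] that assms(4) calculation[of b] by (auto simp: separates_def)
  ultimately have "B = U - A" using assms(1,2) by blast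
  then show ?thesis by (simp add: same_up_to_compl_def)
qed

section \<open>Isometries on subsets\<close>

locale half_isometry =
  fixes U :: "'a set" and m :: nat and F :: "'a set \<Rightarrow> 'a set"
  assumes fin: "finite U" and card_U: "card U = 2 * m" and odd_m: "odd m"
    and bij: "bij_betw F (Pow U) (Pow U)"
    and half: "\<And>A B. A \<subseteq> U \<Longrightarrow> B \<subseteq> U \<Longrightarrow> card (sym_diff A B) = m \<Longrightarrow>
                 card (sym_diff (F A) (F B)) = m"
    and compl: "\<And>A. A \<subseteq> U \<Longrightarrow> F (U - A) = U - F A"
    and F_empty: "same_up_to_compl U {} (F {})"
begin

lemma F_closed: "A \<subseteq> U \<Longrightarrow> F A \<subseteq> U"
  using bij by (auto simp: bij_betw_def)

lemma F_inject: "A \<subseteq> U \<Longrightarrow> B \<subseteq> U \<Longrightarrow> F A = F B \<longleftrightarrow> A = B"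
  using bij by (auto simp: bij_betw_def inj_on_def)

lemma F_surj: assumes "B \<subseteq> U" obtains A where "A \<subseteq> U" "F A = B"
  using bij assms by (auto simp: bij_betw_def image_iff) (metis Pow_iff assms imageE)

lemma finite_sub: "A \<subseteq> U \<Longrightarrow> finite A"
  using fin finite_subset by blast

text \<open>
  The converse of \<open>half\<close> is a matter of finiteness: \<open>F\<close> acts injectively on the finite set of pairs
  at distance \<open>m\<close>, hence as a permutation of it.
\<close>
lemma half_iff:
  assumes "A \<subseteq> U" "B \<subseteq> U"
  shows "card (sym_diff (F A) (F B)) = m \<longleftrightarrow> card (sym_diff A B) = m"
proof -
  let ?R = "{(A, B). A \<subseteq> U \<and> B \<subseteq> U \<and> card (sym_diff A B) = m}"
  have "finite (Pow U \<times> Pow U)" using fin by simp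
  then have R: "finite ?R" by (rule rev_finite_subset) auto
  have inj: "inj_on (map_prod F F) (Pow U \<times> Pow U)"
    using bij by (intro map_prod_inj_on) (auto simp: bij_betw_def)
  have "map_prod F F ` ?R = ?R"
    using R half F_closed by (intro endo_inj_surj inj_on_subset[OF inj]) auto
  moreover have "map_prod F F (A, B) \<in> map_prod F F ` ?R \<longleftrightarrow> (A, B) \<in> ?R"
    using assms by (intro inj_on_image_mem_iff[OF inj]) auto
  ultimately show ?thesis using assms F_closed by simp
qed

lemma common_nbrs_image:
  assumes "A \<subseteq> U" "B \<subseteq> U"
  shows "card {C \<in> Pow U. card (sym_diff (F A) C) = m \<and> card (sym_diff (F B) C) = m} =
         card {C \<in> Pow U. card (sym_diff A C) = m \<and> card (sym_diff B C) = m}"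
    (is "card ?N' = card ?N")
proof -
  have "inj_on F ?N" using bij by (auto simp: bij_betw_def inj_on_def)
  moreover have "F ` ?N = ?N'"
  proof (intro equalityI subsetI)
    fix C assume "C \<in> F ` ?N"
    then show "C \<in> ?N'" using assms by (auto simp: half dest: F_closed)
  next
    fix C assume C: "C \<in> ?N'"
    then obtain D where "D \<subseteq> U" "F D = C" using F_surj by blast
    with C assms have "D \<in> ?N" by (auto simp: half_iff[symmetric])
    with \<open>F D = C\<close> show "C \<in> F ` ?N" by blast
  qed
  ultimately show ?thesis using card_image[of F ?N] by simp
qed

lemma even_dist_iff:
  assumes "A \<subseteq> U" "B \<subseteq> U"
  shows "even (card (sym_diff (F A) (F B))) \<longleftrightarrow> even (card (sym_diff A B))"
proof -
  have iff: "card {C \<in> Pow U. card (sym_diff A C) = m \<and> card (sym_diff B C) = m} > 0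
      \<longleftrightarrow> even (card (sym_diff A B))" if "A \<subseteq> U" "B \<subseteq> U" for A B
    unfolding card_common_nbrs[OF fin card_U that] using nbr_count_pos by simp
  show ?thesis
    using iff[OF assms] iff[OF F_closed[OF assms(1)] F_closed[OF assms(2)]]
      common_nbrs_image[OF assms] by simp
qed

text \<open>
  The graph of the relation ``distance \<open>m\<close>'' determines the numbers of common neighbours, and these
  determine an even distance up to reflection at \<open>m\<close>.
\<close>
lemma even_dist:
  assumes "A \<subseteq> U" "B \<subseteq> U" "even (card (sym_diff A B))"
  shows "card (sym_diff (F A) (F B)) = card (sym_diff A B) \<or>
         card (sym_diff (F A) (F B)) + card (sym_diff A B) = 2 * m"
proof -
  let ?d = "card (sym_diff A B)" and ?d' = "card (sym_diff (F A) (F B))"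
  have e: "even ?d'" using assms even_dist_iff by blast
  have "nbr_count m (?d' div 2) = nbr_count m (?d div 2)"
    using common_nbrs_image[OF assms(1,2)] assms e
    by (simp only: card_common_nbrs[OF fin card_U] F_closed if_True)
  moreover have "?d \<le> 2 * m" "?d' \<le> 2 * m"
    using card_sym_diff_le[OF fin] assms F_closed card_U by metis+
  ultimately have "?d' div 2 = ?d div 2 \<or> ?d' div 2 + ?d div 2 = m"
    by (intro nbr_count_inject) auto
  with e assms(3) show ?thesis by (auto elim!: evenE)
qed

lemma even_card_iff:
  assumes "A \<subseteq> U"
  shows "even (card (F A)) \<longleftrightarrow> even (card A)"
proof -
  have "even (card (F {}))"
    using F_empty card_U by (auto simp: same_up_to_compl_def)
  moreover have "finite (F {})" "finite (F A)" "finite A"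
    using assms F_closed finite_sub by auto
  ultimately show ?thesis
    using even_dist_iff[OF assms, of "{}"] even_card_sym_diff[of "F A" "F {}"] by simp
qed

lemma card_half_iff:
  assumes "A \<subseteq> U"
  shows "card (F A) = m \<longleftrightarrow> card A = m"
proof -
  have "card (U - F A) + card (F A) = 2 * m"
    using assms card_U card_sym_diff_compl[OF fin F_closed, of A "{}"] by simp
  with half_iff[OF assms, of "{}"] F_empty F_closed[OF assms] show ?thesis
    by (auto simp: same_up_to_compl_def Diff_eq_empty_iff[THEN iffD2])
qed

lemma half_same_up_to_compl:
  assumes "A \<subseteq> U" "Y \<subseteq> U" "same_up_to_compl U Y (F Y)"
  shows "card (sym_diff Y (F A)) = m \<longleftrightarrow> card (sym_diff Y A) = m"
proof -
  have "card (sym_diff (U - Y) (F A)) + card (sym_diff Y (F A)) = 2 * m"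
    using assms F_closed card_sym_diff_compl[OF fin] card_U by metis
  then show ?thesis
    using half_iff[OF assms(2,1)] assms(3) by (auto simp: same_up_to_compl_def)
qed

text \<open>
  Exchanging \<open>i\<close> and \<open>j\<close> in a set \<open>Y\<close> that separates them is toggling both. If \<open>A\<close> separates \<open>i\<close> from \<open>j\<close>,
  this changes the distance of \<open>Y\<close> to \<open>A\<close>; otherwise it would not. Since \<open>F\<close> fixes \<open>Y\<close> and its
  exchanged version up to complement, the change is also visible at \<open>F A\<close>.
\<close>
lemma F_separates:
  assumes "A \<subseteq> U" "Y \<subseteq> U" "i \<in> U" "j \<in> U" "separates A i j" "separates Y i j"
    and "card (sym_diff Y A) = m"
    and "same_up_to_compl U Y (F Y)"
    and "same_up_to_compl U (sym_diff Y {i, j}) (F (sym_diff Y {i, j}))"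
  shows "separates (F A) i j"
proof -
  have ij: "i \<noteq> j" using assms(5) by (auto simp: separates_def)
  let ?Y = "sym_diff Y {i, j}"
  have Y: "?Y \<subseteq> U" using assms by auto
  have sw: "sym_diff ?Y B = sym_diff (sym_diff Y B) {i, j}" for B by auto
  have fin_D: "finite (sym_diff Y B)" if "B \<subseteq> U" for B
    using assms(2) that finite_sub by auto
  have "\<not> separates (sym_diff Y A) i j"
    using assms(5,6) by (auto simp: separates_def)
  then have "card (sym_diff ?Y A) \<noteq> m"
    using card_sym_diff_pair_eq_iff[OF fin_D[OF assms(1)] ij] assms(7) unfolding sw by simp
  then have "card (sym_diff ?Y (F A)) \<noteq> m"
    using half_same_up_to_compl[OF assms(1) Y assms(9)] by simp
  moreover have "card (sym_diff Y (F A)) = m"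
    using half_same_up_to_compl[OF assms(1,2,8)] assms(7) by simp
  ultimately have "\<not> separates (sym_diff Y (F A)) i j"
    using card_sym_diff_pair_eq_iff[OF fin_D[OF F_closed[OF assms(1)]] ij] unfolding sw by simp
  with assms(6) show ?thesis by (auto simp: separates_def)
qed

text \<open>
  Every \<open>m\<close>-set has distance \<open>m - 1\<close> or \<open>m + 1\<close> from \<open>{i}\<close>. These two distances are even and each other's
  reflection, and \<open>F\<close> permutes the \<open>m\<close>-sets, so \<open>F {i}\<close> inherits the property. A set \<open>A\<close> with this
  property is tested against an \<open>m\<close>-set comparable with it, whose distance from \<open>A\<close> is the difference
  of \<open>card A\<close> and \<open>m\<close>.
\<close>
lemma singleton_image:
  assumes "i \<in> U"
  shows "\<exists>j\<in>U. same_up_to_compl U {j} (F {i})"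
proof -
  let ?A = "F {i}"
  have A: "?A \<subseteq> U" "finite ?A" "odd (card ?A)"
    using assms F_closed finite_sub even_card_iff[of "{i}"] by auto
  have dist: "card (sym_diff ?A T) = m - 1 \<or> card (sym_diff ?A T) = m + 1"
    if T: "T \<subseteq> U" "card T = m" for T
  proof -
    obtain T0 where T0: "T0 \<subseteq> U" "F T0 = T" using F_surj T by blast
    then have c: "card T0 = m" using card_half_iff T by blast
    have "card (sym_diff {i} T0) + 2 * card ({i} \<inter> T0) = m + 1"
      using card_sym_diff_add[of "{i}" T0] c T0 finite_sub by simp
    moreover have "card ({i} \<inter> T0) = (if i \<in> T0 then 1 else 0)" by simp
    ultimately have d: "card (sym_diff {i} T0) = m - 1 \<or> card (sym_diff {i} T0) = m + 1"
      by (auto split: if_splits)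
    then have "even (card (sym_diff {i} T0))" using odd_m by auto
    from even_dist[OF _ T0(1) this] assms T0(2) d odd_m show ?thesis
      by (auto elim!: oddE)
  qed
  have "card ?A = 1 \<or> card (U - ?A) = 1"
  proof (cases "card ?A \<le> m")
    case True
    have "m - card ?A \<le> card (U - ?A)" using A True card_U by (simp add: card_Diff_subset)
    then obtain D where D: "D \<subseteq> U - ?A" "card D = m - card ?A" "finite D"
      by (metis obtain_subset_with_card_n)
    have "card (?A \<union> D) = m" using D A True by (subst card_Un_disjoint) auto
    moreover have "sym_diff ?A (?A \<union> D) = D" using D by auto
    moreover have "?A \<union> D \<subseteq> U" using A D by auto
    ultimately have "m - card ?A = m - 1 \<or> m - card ?A = m + 1" using dist[of "?A \<union> D"] D by simp
    moreover have "card ?A > 0" using A(3) by (rule odd_pos)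
    ultimately show ?thesis using True by auto
  next
    case False
    then obtain T where T: "T \<subseteq> ?A" "card T = m"
      by (metis obtain_subset_with_card_n nat_le_linear)
    have cU: "card (U - ?A) = 2 * m - card ?A" using A card_U by (simp add: card_Diff_subset)
    have "T \<subseteq> U" using T A by auto
    moreover have "sym_diff ?A T = ?A - T" using T by auto
    moreover have "card (?A - T) = card ?A - m"
      using T card_Diff_subset[OF finite_subset[OF T(1) A(2)] T(1)] by simp
    moreover have "card ?A \<le> 2 * m" using card_mono[OF fin A(1)] card_U by simp
    ultimately have "card ?A = 2 * m - 1" using dist[of T] T(2) False by auto
    then have "card (U - ?A) = 2 * m - (2 * m - 1)" using cU by simp
    then show ?thesis using odd_pos[OF odd_m] by simp
  qed
  then consider j where "?A = {j}" | j where "U - ?A = {j}"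
    by (auto simp: card_1_singleton_iff)
  then show ?thesis
  proof cases
    case 1
    then show ?thesis using A by (auto simp: same_up_to_compl_def)
  next
    case 2
    then have "j \<in> U" "?A = U - {j}" using A by auto
    then show ?thesis by (auto simp: same_up_to_compl_def)
  qed
qed

end

section \<open>Isometries fixing the singletons up to complement\<close>

locale normalised_half_isometry = half_isometry +
  assumes m_gt_1: "m > 1"
    and singletons: "\<And>i. i \<in> U \<Longrightarrow> same_up_to_compl U {i} (F {i})"
begin

text \<open>
  For \<open>i \<in> A\<close> and \<open>j \<notin> A\<close>, the distances of \<open>A\<close> to \<open>{i}\<close> and \<open>{j}\<close> are \<open>card A - 1\<close> and \<open>card A + 1\<close>. Both are
  even, and they are reflections of each other only if \<open>card A = m\<close>. So \<open>F A\<close> also has different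
  distances to \<open>{i}\<close> and \<open>{j}\<close>.
\<close>
lemma fixes_odd:
  assumes "A \<subseteq> U" "odd (card A)" "card A \<noteq> m"
  shows "same_up_to_compl U A (F A)"
proof -
  have "finite A" using assms finite_sub by simp
  have "A \<noteq> {}" "A \<noteq> U" using assms card_U by auto
  then obtain a b where ab: "a \<in> A" "b \<in> U - A" using assms by blast
  show ?thesis
  proof (rule same_up_to_complI[OF assms(1) F_closed[OF assms(1)] ab])
    fix i j assume i: "i \<in> A" and j: "j \<in> U - A"
    show "separates (F A) i j"
    proof (rule ccontr)
      assume ns: "\<not> separates (F A) i j"
      let ?d = "\<lambda>B k. card (sym_diff {k} B)"
      have iU: "i \<in> U" "j \<in> U" using i j assms by auto
      have A: "?d A i + 1 = card A" "?d A j = card A + 1"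
        using card_sym_diff_add[of "{i}" A] card_sym_diff_add[of "{j}" A] i j \<open>finite A\<close> by auto
      have FA: "?d (F A) i = ?d (F A) j"
        using card_sym_diff_add[of "{i}" "F A"] card_sym_diff_add[of "{j}" "F A"] ns
          finite_sub[OF F_closed[OF assms(1)]]
        by (cases "i \<in> F A"; cases "j \<in> F A") (auto simp: separates_def)
      have d: "?d (F A) k = ?d A k \<or> ?d (F A) k + ?d A k = 2 * m"
        if "k \<in> U" "even (?d A k)" for k
      proof -
        have "card (sym_diff (U - {k}) (F A)) + ?d (F A) k = 2 * m"
          using that F_closed[OF assms(1)] card_sym_diff_compl[OF fin] card_U
          by (metis empty_subsetI insert_subset)
        then show ?thesis
          using even_dist[of "{k}" A] that assms singletons[OF that(1)]
          by (auto simp: same_up_to_compl_def)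
      qed
      have ev: "even (?d A i)" "even (?d A j)" using A assms(2) by presburger+
      show False
        using d[OF iU(1) ev(1)] d[OF iU(2) ev(2)] FA A assms(3) by linarith
    qed
  qed
qed

lemma same_compl:
  assumes "A \<subseteq> U" "same_up_to_compl U (U - A) (F (U - A))"
  shows "same_up_to_compl U A (F A)"
proof -
  have "U - F A = U - A \<or> U - F A = A"
    using assms(2) by (simp add: same_up_to_compl_def compl[OF assms(1)] double_diff assms(1))
  then show ?thesis
    using double_diff[OF assms(1) order_refl] double_diff[OF F_closed[OF assms(1)] order_refl]
    unfolding same_up_to_compl_def by metis
qed

text \<open>
  The test set for \<open>F_separates\<close> is \<open>Y = A \<union> D\<close> with an \<open>m\<close>-set \<open>D\<close> disjoint from \<open>A\<close> and avoiding \<open>j\<close>. There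
  is room for \<open>D\<close> because \<open>card A < m\<close>, and \<open>card Y = card A + m\<close> is odd and larger than \<open>m\<close> because \<open>A\<close> is
  nonempty of even size.
\<close>
lemma fixes_even_small:
  assumes "A \<subseteq> U" "even (card A)" "A \<noteq> {}" "card A < m"
  shows "same_up_to_compl U A (F A)"
proof -
  have fA: "finite A" using assms finite_sub by simp
  have cA: "card A > 0" using fA assms(3) by auto
  have "A \<noteq> U" using assms card_U by auto
  then obtain a b where ab: "a \<in> A" "b \<in> U - A" using assms by blast
  show ?thesis
  proof (rule same_up_to_complI[OF assms(1) F_closed[OF assms(1)] ab])
    fix i j assume i: "i \<in> A" and j: "j \<in> U - A"
    have "card (U - A - {j}) = 2 * m - card A - 1"
      using j fA assms card_U by (simp add: card_Diff_subset)
    then have "m \<le> card (U - A - {j})" using assms(4) by simp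
    then obtain D where D: "D \<subseteq> U - A - {j}" "card D = m" "finite D"
      by (metis obtain_subset_with_card_n)
    let ?Y = "A \<union> D"
    have Y: "?Y \<subseteq> U" "finite ?Y" "card ?Y = card A + m"
      using D fA assms(1) by (auto intro!: card_Un_disjoint)
    have sep: "separates ?Y i j" using i j D by (auto simp: separates_def)
    have ne: "i \<noteq> j" using i j by auto
    have c: "card (sym_diff ?Y {i, j}) = card A + m"
      using card_sym_diff_pair_eq_iff[OF Y(2) ne] sep Y(3) by simp
    show "separates (F A) i j"
    proof (rule F_separates[OF assms(1) Y(1) _ _ _ sep])
      have "sym_diff ?Y A = D" using D by auto
      then show "card (sym_diff ?Y A) = m" using D by simp
      show "same_up_to_compl U ?Y (F ?Y)"
        using Y(1) by (rule fixes_odd) (use Y(3) assms(2) odd_m cA in simp_all)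
      have "sym_diff ?Y {i, j} \<subseteq> U" using Y i j assms by auto
      then show "same_up_to_compl U (sym_diff ?Y {i, j}) (F (sym_diff ?Y {i, j}))"
        using c assms(2) odd_m cA by (intro fixes_odd) simp_all
    qed (use i j assms in \<open>auto simp: separates_def\<close>)
  qed
qed

lemma fixes_even:
  assumes "A \<subseteq> U" "even (card A)"
  shows "same_up_to_compl U A (F A)"
proof -
  have empty: "same_up_to_compl U {} (F {})" by (rule F_empty)
  have cU: "card (U - A) = 2 * m - card A"
    using assms card_U finite_sub by (simp add: card_Diff_subset)
  have "card A \<noteq> m" using assms(2) odd_m by blast
  then consider "A = {}" | "A = U" | "A \<noteq> {}" "card A < m" | "A \<noteq> U" "card A > m"
    using linorder_less_linear[of "card A" m] by blast
  then show ?thesis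
  proof cases
    case 1 then show ?thesis using empty by simp
  next
    case 2 then show ?thesis using empty same_compl[of U] by simp
  next
    case 3 with assms show ?thesis by (intro fixes_even_small)
  next
    case 4
    from 4 assms(1) have "U - A \<noteq> {}" by (simp add: subset_antisym)
    moreover have "card (U - A) < m" using 4 cU odd_pos[OF odd_m] by simp
    moreover have "even (card (U - A))" using cU assms(2) by simp
    ultimately have "same_up_to_compl U (U - A) (F (U - A))"
      by (intro fixes_even_small Diff_subset)
    then show ?thesis by (rule same_compl[OF assms(1)])
  qed
qed

text \<open>
  Here any translate \<open>Y\<close> of \<open>A\<close> by an \<open>m\<close>-set avoiding \<open>i\<close> and \<open>j\<close> has even size, so the sets that are
  already known to be fixed can serve as test sets for \<open>F_separates\<close>.
\<close>
lemma fixes_half: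
  assumes "A \<subseteq> U" "card A = m"
  shows "same_up_to_compl U A (F A)"
proof -
  have fA: "finite A" using assms finite_sub by simp
  have "A \<noteq> {}" "A \<noteq> U" using assms card_U m_gt_1 by auto
  then obtain a b where ab: "a \<in> A" "b \<in> U - A" using assms by blast
  show ?thesis
  proof (rule same_up_to_complI[OF assms(1) F_closed[OF assms(1)] ab])
    fix i j assume i: "i \<in> A" and j: "j \<in> U - A"
    then have ne: "i \<noteq> j" and ijU: "{i, j} \<subseteq> U" using assms by auto
    have "card (U - {i, j}) = 2 * m - 2"
      using ijU ne card_U by (simp add: card_Diff_subset)
    then have "m \<le> card (U - {i, j})" using m_gt_1 by simp
    then obtain D where D: "D \<subseteq> U - {i, j}" "card D = m" "finite D"
      by (metis obtain_subset_with_card_n)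
    let ?Y = "sym_diff A D"
    have Y: "?Y \<subseteq> U" "finite ?Y" "even (card ?Y)"
      using D fA assms even_card_sym_diff[of A D] by auto
    have sep: "separates ?Y i j" using i j D by (auto simp: separates_def)
    have c: "card (sym_diff ?Y {i, j}) = card ?Y"
      using card_sym_diff_pair_eq_iff[OF Y(2) ne] sep by simp
    show "separates (F A) i j"
    proof (rule F_separates[OF assms(1) Y(1) _ _ _ sep])
      have "sym_diff ?Y A = D" by auto
      then show "card (sym_diff ?Y A) = m" using D by simp
      show "same_up_to_compl U ?Y (F ?Y)" using Y by (intro fixes_even)
      have "sym_diff ?Y {i, j} \<subseteq> U" using Y ijU by auto
      then show "same_up_to_compl U (sym_diff ?Y {i, j}) (F (sym_diff ?Y {i, j}))"
        using c Y(3) by (intro fixes_even) simp_all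
    qed (use i j assms in \<open>auto simp: separates_def\<close>)
  qed
qed

lemma fixes_all: "A \<subseteq> U \<Longrightarrow> same_up_to_compl U A (F A)"
  using fixes_odd fixes_even fixes_half by blast

end

context half_isometry
begin

text \<open>
  If \<open>m = 1\<close>, the two singletons are complements of each other and \<open>F\<close> does not determine a
  permutation of them; but then \<open>F\<close> is the identity up to complement. If \<open>m > 1\<close>, the images of
  the singletons define the permutation.
\<close>
theorem F_eq_permutation_up_to_compl:
  "\<exists>\<sigma>. \<sigma> permutes U \<and> (\<forall>A. A \<subseteq> U \<longrightarrow> same_up_to_compl U (\<sigma> ` A) (F A))"
proof (cases "m = 1")
  case True
  have "same_up_to_compl U A (F A)" if "A \<subseteq> U" for A
  proof -
    have "card A \<le> 2" using that True card_U fin card_mono by fastforce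
    then consider "card A = 0" | "card A = 1" | "card A = card U" using True card_U by fastforce
    then show ?thesis
    proof cases
      case 1
      then show ?thesis using that F_empty finite_sub by simp
    next
      case 3
      then have "A = U" using that fin by (metis card_subset_eq)
      then show ?thesis using compl[of "{}"] F_empty by (auto simp: same_up_to_compl_def)
    next
      case 2
      then obtain a where a: "A = {a}" by (auto simp: card_1_singleton_iff)
      have "card (U - A) = 1" using 2 that True card_U finite_sub by (simp add: card_Diff_subset)
      then obtain b where b: "U - A = {b}" by (auto simp: card_1_singleton_iff)
      have "card (F A) = 1" using card_half_iff[OF that] 2 True by simp
      then obtain c where "F A = {c}" by (auto simp: card_1_singleton_iff)
      moreover from this have "c \<in> A \<or> c \<in> U - A" using F_closed[OF that] by auto
      ultimately show ?thesis unfolding same_up_to_compl_def b using a by auto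
    qed
  qed
  then show ?thesis by (intro exI[of _ id]) (auto simp: permutes_id)
next
  case False
  then have m1: "m > 1" using odd_m by (cases m) auto
  obtain \<rho> where \<rho>: "\<And>i. i \<in> U \<Longrightarrow> \<rho> i \<in> U \<and> same_up_to_compl U {\<rho> i} (F {i})"
    using singleton_image by metis
  have inj: "inj_on \<rho> U"
  proof (rule inj_onI)
    fix i j assume ij: "i \<in> U" "j \<in> U" "\<rho> i = \<rho> j"
    then have "F {i} = {\<rho> j} \<or> F {i} = U - {\<rho> j}" "F {j} = {\<rho> j} \<or> F {j} = U - {\<rho> j}"
      using \<rho>[of i] \<rho>[of j] by (simp_all add: same_up_to_compl_def)
    moreover have "U - (U - {\<rho> j}) = {\<rho> j}" using \<rho>[of j] ij by blast
    ultimately have "F {i} = F {j} \<or> F {i} = U - F {j}" by (elim disjE) simp_all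
    then have "F {i} = F {j} \<or> F {i} = F (U - {j})" using compl[of "{j}"] ij by simp
    then have "{i} = {j} \<or> {i} = U - {j}"
      using ij F_inject[of "{i}" "{j}"] F_inject[of "{i}" "U - {j}"] by simp
    moreover have "card (U - {j}) \<noteq> card {i}" using ij card_U m1 by simp
    ultimately have "{i} = {j}" by fastforce
    then show "i = j" by simp
  qed
  define \<sigma> where "\<sigma> i = (if i \<in> U then \<rho> i else i)" for i
  have "inj_on \<sigma> U" using inj by (auto simp: \<sigma>_def inj_on_def)
  moreover have "\<sigma> ` U \<subseteq> U" using \<rho> by (auto simp: \<sigma>_def)
  ultimately have "bij_betw \<sigma> U U" using endo_inj_surj[OF fin] by (auto simp: bij_betw_def)
  then have perm: "\<sigma> permutes U" by (rule bij_imp_permutes) (simp add: \<sigma>_def)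
  let ?\<tau> = "inv \<sigma>"
  have \<tau>: "?\<tau> permutes U" using perm by (rule permutes_inv)
  have inj\<tau>: "inj ?\<tau>" using \<tau> by (rule permutes_inj)
  have sub: "?\<tau> ` A \<subseteq> U \<longleftrightarrow> A \<subseteq> U" for A
    using \<tau> inj\<tau> by (metis inj_image_subset_iff permutes_image)
  have cp: "?\<tau> ` (U - A) = U - ?\<tau> ` A" for A
    using \<tau> inj\<tau> by (simp add: image_set_diff permutes_image)
  have \<sigma>\<tau>: "\<sigma> ` ?\<tau> ` A = A" "?\<tau> ` \<sigma> ` A = A" for A
    using perm by (auto simp: image_image permutes_inverses)
  define G where "G A = ?\<tau> ` F A" for A
  have same: "same_up_to_compl U B (G A) \<longleftrightarrow> same_up_to_compl U (\<sigma> ` B) (F A)" for A B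
  proof -
    have "?\<tau> ` C = D \<longleftrightarrow> C = \<sigma> ` D" for C D using \<sigma>\<tau> by metis
    moreover have "\<sigma> ` (U - B) = U - \<sigma> ` B"
      using perm by (simp add: image_set_diff permutes_inj permutes_image)
    ultimately show ?thesis by (simp add: same_up_to_compl_def G_def)
  qed
  interpret G: normalised_half_isometry U m G
  proof
    show "finite U" "card U = 2 * m" "odd m" "m > 1" by (rule fin card_U odd_m m1)+
    have "bij_betw ((`) ?\<tau>) (Pow U) (Pow U)"
      using \<tau> by (intro bij_betw_Pow permutes_imp_bij)
    then show "bij_betw G (Pow U) (Pow U)"
      unfolding G_def using bij_betw_trans[OF bij] by (simp add: comp_def)
    show "G (U - A) = U - G A" if "A \<subseteq> U" for A
      using that by (simp add: G_def compl cp)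
    show "card (sym_diff (G A) (G B)) = m" if "A \<subseteq> U" "B \<subseteq> U" "card (sym_diff A B) = m" for A B
    proof -
      have "sym_diff (G A) (G B) = ?\<tau> ` sym_diff (F A) (F B)"
        using inj\<tau> by (simp add: G_def image_set_diff image_Un)
      then show ?thesis using half[OF that] inj\<tau> by (simp add: card_image inj_on_subset)
    qed
    show "same_up_to_compl U {} (G {})" using F_empty by (simp add: same)
    show "same_up_to_compl U {i} (G {i})" if "i \<in> U" for i
      using that \<rho> by (simp add: same \<sigma>_def)
  qed
  have "same_up_to_compl U (\<sigma> ` A) (F A)" if "A \<subseteq> U" for A
    using G.fixes_all[OF that] by (simp add: same)
  with perm show ?thesis by blast
qed

end

section \<open>Words and their supports\<close>

(* Keeps the index set {1..n} from being rewritten to {Suc 0..n}. *)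
declare One_nat_def [simp del]

definition support :: "nat \<Rightarrow> (nat \<Rightarrow> bit) \<Rightarrow> nat set" where
  "support n x = {i \<in> {1..n}. x i \<noteq> 0}"

definition word_of :: "nat \<Rightarrow> nat set \<Rightarrow> nat \<Rightarrow> bit" where
  "word_of n A = (\<lambda>i\<in>{1..n}. if i \<in> A then 1 else 0)"

lemma support_subset: "support n x \<subseteq> {1..n}"
  by (auto simp: support_def)

lemma word_of_in_cube: "word_of n A \<in> cube n"
  by (auto simp: word_of_def cube_def)

lemma support_word_of: "A \<subseteq> {1..n} \<Longrightarrow> support n (word_of n A) = A"
  by (auto simp: support_def word_of_def)

lemma cube_eqI:
  assumes "x \<in> cube n" "y \<in> cube n" "support n x = support n y"
  shows "x = y"
proof (rule PiE_ext[OF assms(1,2)[unfolded cube_def]])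
  fix i assume "i \<in> {1..n}"
  then have "x i \<noteq> 0 \<longleftrightarrow> y i \<noteq> 0" using assms(3) by (auto simp: support_def)
  then show "x i = y i" by (cases "x i"; cases "y i") auto
qed

lemma word_of_support: "x \<in> cube n \<Longrightarrow> word_of n (support n x) = x"
  by (intro cube_eqI) (auto simp: word_of_in_cube support_word_of support_subset)

lemma bij_betw_word_of: "bij_betw (word_of n) (Pow {1..n}) (cube n)"
  by (rule bij_betw_byWitness[where f' = "support n"])
    (auto simp: word_of_in_cube support_word_of word_of_support support_subset
          dest: subsetD[OF support_subset])

lemma bij_betw_support: "bij_betw (support n) (cube n) (Pow {1..n})"
  by (rule bij_betw_byWitness[where f' = "word_of n"])
    (auto simp: word_of_in_cube support_word_of word_of_support support_subset
          dest: subsetD[OF support_subset])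

lemma hamming_dist_support: "hamming_dist n x y = card (sym_diff (support n x) (support n y))"
proof -
  have "x i \<noteq> y i \<longleftrightarrow> (x i \<noteq> 0) \<noteq> (y i \<noteq> 0)" for i
    by (cases "x i"; cases "y i") auto
  then have "{i \<in> {1..n}. x i \<noteq> y i} = sym_diff (support n x) (support n y)"
    unfolding support_def by blast
  then show ?thesis by (simp add: hamming_dist_def)
qed

lemma support_zero_word: "support n (zero_word n) = {}"
  by (auto simp: support_def zero_word_def)

lemma support_one_word: "support n (one_word n) = {1..n}"
  by (auto simp: support_def one_word_def)

lemma zero_word_in_cube: "zero_word n \<in> cube n" and one_word_in_cube: "one_word n \<in> cube n"
  by (auto simp: zero_word_def one_word_def cube_def)

lemma add_word_in_cube: "add_word n x y \<in> cube n"
  by (auto simp: add_word_def cube_def)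

lemma add_word_commute: "add_word n x y = add_word n y x"
  by (simp only: add_word_def add.commute)

lemma support_add_one: "support n (add_word n x (one_word n)) = {1..n} - support n x"
proof -
  have "x i + 1 \<noteq> 0 \<longleftrightarrow> x i = 0" for i by (cases "x i") auto
  then show ?thesis by (auto simp: support_def add_word_def one_word_def)
qed

lemma add_one_add_one: "x \<in> cube n \<Longrightarrow> add_word n (add_word n x (one_word n)) (one_word n) = x"
  by (intro cube_eqI) (auto simp: add_word_in_cube support_add_one double_diff support_subset)

lemma perm_word_in_cube: "perm_word n \<pi> x \<in> cube n"
  by (auto simp: perm_word_def cube_def)

lemma support_perm_word:
  assumes "\<pi> permutes {1..n}"
  shows "support n (perm_word n \<pi> x) = inv \<pi> ` support n x"
proof -
  have "i \<in> support n (perm_word n \<pi> x) \<longleftrightarrow> \<pi> i \<in> support n x" for i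
    using permutes_in_image[OF assms, of i] by (auto simp: support_def perm_word_def)
  then show ?thesis
    using assms by (force simp: permutes_inverses image_iff)
qed

lemma perm_word_add_one:
  assumes "\<pi> permutes {1..n}"
  shows "perm_word n \<pi> (add_word n x (one_word n)) = add_word n (perm_word n \<pi> x) (one_word n)"
proof (rule ext)
  fix i
  show "perm_word n \<pi> (add_word n x (one_word n)) i = add_word n (perm_word n \<pi> x) (one_word n) i"
    using permutes_in_image[OF assms, of i] by (auto simp: perm_word_def add_word_def one_word_def)
qed

lemma hamming_dist_eq_n_iff:
  assumes "x \<in> cube n" "y \<in> cube n"
  shows "hamming_dist n x y = n \<longleftrightarrow> y = add_word n x (one_word n)"
proof
  assume "hamming_dist n x y = n"
  then have "card (sym_diff (support n x) (support n y)) = card {1..n}"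
    by (simp add: hamming_dist_support)
  then have "sym_diff (support n x) (support n y) = {1..n}"
    using support_subset[of n x] support_subset[of n y] by (intro card_subset_eq) auto
  then have "support n y = {1..n} - support n x"
    using support_subset[of n x] support_subset[of n y] by blast
  then show "y = add_word n x (one_word n)"
    by (intro cube_eqI[OF assms(2) add_word_in_cube]) (simp only: support_add_one)
next
  assume "y = add_word n x (one_word n)"
  then have "sym_diff (support n x) (support n y) = {1..n}"
    using support_subset[of n x] by (auto simp: support_add_one)
  then show "hamming_dist n x y = n" by (simp add: hamming_dist_support)
qed

lemma hamming_dist_eq_0_iff:
  assumes "x \<in> cube n" "y \<in> cube n"
  shows "hamming_dist n x y = 0 \<longleftrightarrow> x = y"
proof -
  have "finite (support n x)" "finite (support n y)"
    using finite_subset[OF support_subset] by auto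
  then have "hamming_dist n x y = 0 \<longleftrightarrow> support n x = support n y"
    by (auto simp: hamming_dist_support)
  then show ?thesis using cube_eqI[OF assms] by metis
qed

lemma hamming_dist_add_one:
  "hamming_dist n (add_word n x (one_word n)) y + hamming_dist n x y = n"
  "hamming_dist n x (add_word n y (one_word n)) + hamming_dist n x y = n"
  using card_sym_diff_compl[of "{1..n}" "support n x" "support n y"]
    card_sym_diff_compl[of "{1..n}" "support n y" "support n x"]
  by (simp_all add: hamming_dist_support support_add_one support_subset Un_commute)

lemma hamming_dist_perm_word:
  assumes "\<pi> permutes {1..n}"
  shows "hamming_dist n (perm_word n \<pi> x) (perm_word n \<pi> y) = hamming_dist n x y"
proof -
  have inj: "inj (inv \<pi>)" using assms by (intro permutes_inj permutes_inv)
  then have "sym_diff (inv \<pi> ` support n x) (inv \<pi> ` support n y)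
      = inv \<pi> ` sym_diff (support n x) (support n y)"
    by (simp add: image_set_diff image_Un)
  then show ?thesis
    using inj by (simp add: hamming_dist_support support_perm_word[OF assms] card_image inj_on_subset)
qed

text \<open>
  So \<open>X\<close> meets every pair of complementary words, and a suitable \<open>S \<subseteq> X\<close> can mark any set of such pairs.
\<close>
lemma complement_in_X:
  assumes "c \<in> cube n" "n = 2 * m" "m > 0" "c \<notin> X n"
  shows "add_word n c (one_word n) \<in> X n"
proof -
  let ?c = "add_word n c (one_word n)"
  have w: "weight n x = card (support n x)" for x by (simp add: weight_def support_def)
  have "card (support n c) \<le> card {1..n}" by (intro card_mono support_subset) simp
  then have sum: "weight n ?c + weight n c = n"
    by (simp add: w support_add_one card_Diff_subset support_subset finite_subset[OF support_subset])
  have one: "?c 1 = 0" if "c 1 \<noteq> 0"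
    using that assms(2,3) by (cases "c 1") (auto simp: add_word_def one_word_def)
  have "?c \<in> cube n" by (rule add_word_in_cube)
  then show ?thesis using assms(1,2,4) sum one by (auto simp: X_def X1_def X2_def)
qed

section \<open>The characterisation\<close>

lemma isometry_fixing_constants_is_flipped_perm:
  assumes n: "n = 2 * m" "odd m"
    and iso: "dist_isometry n {n div 2, n} \<phi>"
    and fix01: "\<phi> ` {zero_word n, one_word n} = {zero_word n, one_word n}"
  shows "\<exists>\<pi> S. \<pi> permutes {1..n} \<and> S \<subseteq> X n \<and> (\<forall>c\<in>cube n. \<phi> c = flipped_perm n \<pi> S c)"
proof -
  have bij: "bij_betw \<phi> (cube n) (cube n)" using iso by (simp add: dist_isometry_def)
  then have closed: "\<phi> c \<in> cube n" if "c \<in> cube n" for c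
    using that by (rule bij_betw_apply)
  have \<phi>_half: "hamming_dist n (\<phi> x) (\<phi> y) = m"
    if "x \<in> cube n" "y \<in> cube n" "hamming_dist n x y = m" for x y
    using iso that n by (simp add: dist_isometry_def)
  have \<phi>_compl: "\<phi> (add_word n x (one_word n)) = add_word n (\<phi> x) (one_word n)"
    if x: "x \<in> cube n" for x
  proof -
    let ?x = "add_word n x (one_word n)"
    have c: "?x \<in> cube n" by (rule add_word_in_cube)
    have "hamming_dist n x ?x = n" using hamming_dist_eq_n_iff[OF x c] by simp
    then have "hamming_dist n (\<phi> x) (\<phi> ?x) = n"
      using iso x c unfolding dist_isometry_def by blast
    then show ?thesis using hamming_dist_eq_n_iff[OF closed[OF x] closed[OF c]] by simp
  qed
  define F where "F A = support n (\<phi> (word_of n A))" for A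
  interpret half_isometry "{1..n}" m F
  proof
    show "finite {1..n}" "card {1..n} = 2 * m" "odd m" using n by auto
    have "bij_betw (support n \<circ> (\<phi> \<circ> word_of n)) (Pow {1..n}) (Pow {1..n})"
      by (intro bij_betw_trans[OF _ bij_betw_support] bij_betw_trans[OF bij_betw_word_of] bij)
    then show "bij_betw F (Pow {1..n}) (Pow {1..n})" by (simp add: F_def[abs_def] comp_def)
    show "card (sym_diff (F A) (F B)) = m"
      if "A \<subseteq> {1..n}" "B \<subseteq> {1..n}" "card (sym_diff A B) = m" for A B
      using \<phi>_half[of "word_of n A" "word_of n B"] that
      by (simp add: F_def hamming_dist_support support_word_of word_of_in_cube)
    show "F ({1..n} - A) = {1..n} - F A" if "A \<subseteq> {1..n}" for A
    proof -
      have "word_of n ({1..n} - A) = add_word n (word_of n A) (one_word n)"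
        by (rule cube_eqI[of _ n])
          (simp_all add: that word_of_in_cube add_word_in_cube support_word_of support_add_one)
      then show ?thesis using \<phi>_compl[OF word_of_in_cube] by (simp add: F_def support_add_one)
    qed
    have "word_of n {} = zero_word n" by (auto simp: word_of_def zero_word_def)
    moreover have "\<phi> (zero_word n) \<in> {zero_word n, one_word n}" using fix01 by blast
    ultimately show "same_up_to_compl {1..n} {} (F {})"
      by (auto simp: F_def same_up_to_compl_def support_zero_word support_one_word)
  qed
  obtain \<sigma> where \<sigma>: "\<sigma> permutes {1..n}"
    and F: "\<And>A. A \<subseteq> {1..n} \<Longrightarrow> same_up_to_compl {1..n} (\<sigma> ` A) (F A)"
    using F_eq_permutation_up_to_compl by blast
  define \<pi> where "\<pi> = inv \<sigma>"
  have \<pi>: "\<pi> permutes {1..n}" using \<sigma> by (simp add: \<pi>_def permutes_inv)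
  have inv: "inv \<pi> = \<sigma>" using \<sigma> by (simp add: \<pi>_def permutes_inv_inv)
  have \<phi>: "\<phi> c = perm_word n \<pi> c \<or> \<phi> c = add_word n (perm_word n \<pi> c) (one_word n)"
    if c: "c \<in> cube n" for c
  proof -
    have "same_up_to_compl {1..n} (support n (perm_word n \<pi> c)) (support n (\<phi> c))"
      using F[OF support_subset, of c] c
      by (simp add: F_def word_of_support support_perm_word[OF \<pi>] inv)
    then show ?thesis
      using cube_eqI[OF closed[OF c]] perm_word_in_cube add_word_in_cube
      by (auto simp: same_up_to_compl_def support_add_one)
  qed
  define S where "S = {c \<in> X n. \<phi> c \<noteq> perm_word n \<pi> c}"
  have "\<phi> c = flipped_perm n \<pi> S c" if c: "c \<in> cube n" for c
  proof -
    let ?c = "add_word n (one_word n) c"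
    have c': "?c = add_word n c (one_word n)" by (rule add_word_commute)
    have eq: "\<phi> ?c = perm_word n \<pi> ?c \<longleftrightarrow> \<phi> c = perm_word n \<pi> c"
      unfolding c' \<phi>_compl[OF c] perm_word_add_one[OF \<pi>]
      using add_one_add_one[OF closed[OF c]] add_one_add_one[OF perm_word_in_cube, of n \<pi> c] by metis
    have "c \<in> X n \<or> ?c \<in> X n"
      using complement_in_X[OF c n(1)] odd_pos[OF n(2)] c' by auto
    then have "{c, ?c} \<inter> S = {} \<longleftrightarrow> \<phi> c = perm_word n \<pi> c"
      using eq by (auto simp: S_def)
    then show ?thesis using \<phi>[OF c] by (auto simp: flipped_perm_def)
  qed
  moreover have "S \<subseteq> X n" by (auto simp: S_def)
  ultimately show ?thesis using \<pi> by blast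
qed

text \<open>
  Flipping one of two words reflects their distance at \<open>n/2\<close>, so the distance \<open>n/2\<close> survives any
  flips. The distance \<open>n\<close> survives because \<open>S\<close> acts on complementary pairs: both words of a pair are
  flipped or neither is. Injectivity follows, since two distinct words with the same image would have to be
  at distance \<open>n\<close>.
\<close>
lemma flipped_perm_is_isometry:
  assumes "n > 0" "even n" "\<pi> permutes {1..n}"
  shows "dist_isometry n {n div 2, n} (flipped_perm n \<pi> S)"
    and "flipped_perm n \<pi> S ` {zero_word n, one_word n} = {zero_word n, one_word n}"
proof -
  let ?f = "flipped_perm n \<pi> S" and ?P = "perm_word n \<pi>"
  let ?compl = "\<lambda>x. add_word n x (one_word n)"
  define flip where "flip c \<longleftrightarrow> {c, ?compl c} \<inter> S \<noteq> {}" for c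
  have f: "?f c = (if flip c then ?compl (?P c) else ?P c)" for c
    by (simp add: flipped_perm_def flip_def add_word_commute[of n "one_word n"])
  have flip_compl: "flip (?compl c) = flip c" if "c \<in> cube n" for c
    using that by (auto simp: flip_def add_one_add_one)
  have closed: "?f c \<in> cube n" for c by (simp add: f add_word_in_cube perm_word_in_cube)
  have same: "hamming_dist n (?f x) (?f y) = hamming_dist n x y" if "flip x = flip y" for x y
    using that hamming_dist_add_one(1)[of n "?P x" "?compl (?P y)"]
      hamming_dist_add_one(2)[of n "?P x" "?P y"] hamming_dist_perm_word[OF assms(3), of x y]
    by (simp add: f)
  have diff: "hamming_dist n (?f x) (?f y) + hamming_dist n x y = n" if "flip x \<noteq> flip y" for x y
    using that hamming_dist_add_one[of n "?P x" "?P y"] hamming_dist_perm_word[OF assms(3), of x y]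
    by (auto simp: f)
  have antipodal: "hamming_dist n (?f x) (?f y) = n"
    if "x \<in> cube n" "y \<in> cube n" "hamming_dist n x y = n" for x y
    using same[of x y] flip_compl[of x] hamming_dist_eq_n_iff[of x n y] that by simp
  have "inj_on ?f (cube n)"
  proof (rule inj_onI)
    fix x y assume xy: "x \<in> cube n" "y \<in> cube n" and "?f x = ?f y"
    then have "hamming_dist n (?f x) (?f y) = 0" using hamming_dist_eq_0_iff[OF closed closed] by simp
    then have "hamming_dist n x y = 0"
      using same[of x y] diff[of x y] antipodal[OF xy] assms(1) by fastforce
    then show "x = y" using hamming_dist_eq_0_iff[OF xy] by simp
  qed
  moreover have "finite (cube n)" using bij_betw_finite[OF bij_betw_support[of n]] by simp
  ultimately have "bij_betw ?f (cube n) (cube n)"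
    using closed endo_inj_surj[of "cube n" ?f] by (auto simp: bij_betw_def)
  moreover have "hamming_dist n (?f x) (?f y) = n div 2" if "hamming_dist n x y = n div 2" for x y
    using same[of x y] diff[of x y] that assms(2) by (cases "flip x = flip y") (auto elim!: evenE)
  ultimately show "dist_isometry n {n div 2, n} ?f"
    using antipodal by (auto simp: dist_isometry_def)
  have "?compl (zero_word n) = one_word n" "?compl (one_word n) = zero_word n"
    by (auto intro!: cube_eqI[of _ n] simp: add_word_in_cube zero_word_in_cube one_word_in_cube
        support_add_one support_zero_word support_one_word)
  moreover have "?P (zero_word n) = zero_word n"
    by (auto intro!: cube_eqI[of _ n] simp: perm_word_in_cube zero_word_in_cube
        support_perm_word[OF assms(3)] support_zero_word)
  moreover have "?P (one_word n) = one_word n"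
    using permutes_image[OF permutes_inv[OF assms(3)]]
    by (auto intro!: cube_eqI[of _ n] simp: perm_word_in_cube one_word_in_cube
        support_perm_word[OF assms(3)] support_one_word)
  moreover have "flip (one_word n) = flip (zero_word n)"
    using flip_compl[OF zero_word_in_cube] calculation(1) by simp
  ultimately show "?f ` {zero_word n, one_word n} = {zero_word n, one_word n}"
    by (auto simp: f)
qed

theorem theorem4:
  fixes n :: nat
  assumes "2 dvd n" and "\<not> 4 dvd n"
  shows "(\<forall>\<phi>. dist_isometry n {n div 2, n} \<phi> \<and>
              \<phi> ` {zero_word n, one_word n} = {zero_word n, one_word n} \<longrightarrow>
            (\<exists>\<pi> S. \<pi> permutes {1..n} \<and> S \<subseteq> X n \<and> (\<forall>c\<in>cube n. \<phi> c = flipped_perm n \<pi> S c)))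
       \<and> (\<forall>\<pi> S. \<pi> permutes {1..n} \<and> S \<subseteq> X n \<longrightarrow>
            dist_isometry n {n div 2, n} (flipped_perm n \<pi> S) \<and>
            flipped_perm n \<pi> S ` {zero_word n, one_word n} = {zero_word n, one_word n})"
proof -
  obtain m where m: "n = 2 * m" using assms(1) by blast
  then have odd: "odd m" using assms(2) by auto
  then have "n > 0" using m odd_pos by auto
  then have iso: "dist_isometry n {n div 2, n} (flipped_perm n \<pi> S)"
    and fix01: "flipped_perm n \<pi> S ` {zero_word n, one_word n} = {zero_word n, one_word n}"
    if "\<pi> permutes {1..n}" for \<pi> S
    using flipped_perm_is_isometry assms(1) that by simp_all
  show ?thesis
    using isometry_fixing_constants_is_flipped_perm[OF m odd] iso fix01 by simp
qed

end
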